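(* For each integer $n\ge 0$, the cubical singular homology group $dH_n(-)$, with $f\mapsto f_*=dH_n(f)$ on morphisms, is a functor from the category $\mathsf{Dig}$ of digital images to the category $\mathsf{Ab}$ of abelian groups.
   Context: A digital image $(X,\kappa)$ is a finite subset $X\subset\mathbb{Z}^d$ ($d\ge 1$) equipped with an adjacency relation $\kappa=c_l$ for some $1\le l\le d$, where distinct points $p,q\in\mathbb{Z}^d$ are $c_l$-adjacent if at most $l$ of their coordinates differ by one unit and all remaining coordinates are equal. A function $f:(X,\kappa)\to(Y,\lambda)$ is $(\kappa,\lambda)$-continuous if whenever $x_0,x_1$ are $\kappa$-adjacent, $f(x_0),f(x_1)$ are equal or $\lambda$-adjacent. $\mathsf{Dig}$ is the category whose objects are digital images and whose morphisms $(X,\kappa)\to(Y,\lambda)$ are the $(\kappa,\lambda)$-continuous functions. Cubical singular homology. $I=\{0,1\}\subset\mathbb{Z}$, and $I^n$ carries the $c_1$-adjacency of $\mathbb{Z}^n$ (denoted $2n$); $I^0$ is a point. A digital $n$-cube in $(X,\kappa)$ is a $(2n,\kappa)$-continuous map $T:I^n\to X$; it is degenerate if for some $i$, $T(t_1,\dots,t_n)$ does not depend on $t_i$. $dQ_n(X)$ is the free abelian group on digital $n$-cubes, $dD_n(X)$ the subgroup generated by degenerate ones, $dC_n(X)=dQ_n(X)/dD_n(X)$ (zero for $n<0$). Put $A_iT(t_1,\dots,t_{n-1})=T(t_1,\dots,t_{i-1},0,t_i,\dots,t_{n-1})$, $B_iT(t_1,\dots,t_{n-1})=T(t_1,\dots,t_{i-1},1,t_i,\dots,t_{n-1})$,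 $\partial_n T=\sum_{i=1}^n(-1)^i(A_iT-B_iT)$ (with $\partial_n=0$ for $n\le0$); this induces a boundary map on $dC_\bullet(X)$ with $\partial\partial=0$, and $dH_n(X)=\ker\partial_n/\operatorname{im}\partial_{n+1}$ is the homology of $(dC_\bullet(X),\partial)$. For a $(\kappa,\lambda)$-continuous $f:X\to Y$, $f_\#:dC_n(X)\to dC_n(Y)$ is given by $T\mapsto f\circ T$ extended linearly, and $f_*=dH_n(f):dH_n(X)\to dH_n(Y)$ is given by $[z]\mapsto[f_\#(z)]$. *)

theory Defs
  imports "HOL-Algebra.Free_Abelian_Groups"
begin

section \<open>Categories and functors\<close>

text \<open>Morphisms carry no domain or codomain of their own: a morphism \<open>f\<close> from \<open>A\<close> to \<open>B\<close> is an
  element of \<open>Hom C A B\<close>, the sets \<open>Hom C A B\<close> need not be disjoint, and composition and the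
  morphism part of a functor take the objects involved as arguments.
  \<open>Comp C X Y Z g f\<close> is \<open>g\<close> after \<open>f\<close>.\<close>

record ('o, 'm) category =
  Obj :: "'o set"
  Hom :: "'o \<Rightarrow> 'o \<Rightarrow> 'm set"
  Ident :: "'o \<Rightarrow> 'm"
  Comp :: "'o \<Rightarrow> 'o \<Rightarrow> 'o \<Rightarrow> 'm \<Rightarrow> 'm \<Rightarrow> 'm"

locale is_category =
  fixes C :: "('o, 'm) category"
  assumes Ident_in_Hom: "X \<in> Obj C \<Longrightarrow> Ident C X \<in> Hom C X X"
    and Comp_in_Hom: "\<lbrakk>X \<in> Obj C; Y \<in> Obj C; Z \<in> Obj C; f \<in> Hom C X Y; g \<in> Hom C Y Z\<rbrakk>
      \<Longrightarrow> Comp C X Y Z g f \<in> Hom C X Z"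
    and Comp_Ident_right: "\<lbrakk>X \<in> Obj C; Y \<in> Obj C; f \<in> Hom C X Y\<rbrakk>
      \<Longrightarrow> Comp C X X Y f (Ident C X) = f"
    and Comp_Ident_left: "\<lbrakk>X \<in> Obj C; Y \<in> Obj C; f \<in> Hom C X Y\<rbrakk>
      \<Longrightarrow> Comp C X Y Y (Ident C Y) f = f"
    and Comp_assoc: "\<lbrakk>W \<in> Obj C; X \<in> Obj C; Y \<in> Obj C; Z \<in> Obj C;
        f \<in> Hom C W X; g \<in> Hom C X Y; h \<in> Hom C Y Z\<rbrakk>
      \<Longrightarrow> Comp C W Y Z h (Comp C W X Y g f) = Comp C W X Z (Comp C X Y Z h g) f"

locale is_functor = source: is_category C + target: is_category D
  for C :: "('o, 'm) category" and D :: "('p, 'k) category" +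
  fixes Fobj :: "'o \<Rightarrow> 'p" and Fmor :: "'o \<Rightarrow> 'o \<Rightarrow> 'm \<Rightarrow> 'k"
  assumes Fobj_in_Obj: "X \<in> Obj C \<Longrightarrow> Fobj X \<in> Obj D"
    and Fmor_in_Hom: "\<lbrakk>X \<in> Obj C; Y \<in> Obj C; f \<in> Hom C X Y\<rbrakk>
      \<Longrightarrow> Fmor X Y f \<in> Hom D (Fobj X) (Fobj Y)"
    and Fmor_Ident: "X \<in> Obj C \<Longrightarrow> Fmor X X (Ident C X) = Ident D (Fobj X)"
    and Fmor_Comp: "\<lbrakk>X \<in> Obj C; Y \<in> Obj C; Z \<in> Obj C; f \<in> Hom C X Y; g \<in> Hom C Y Z\<rbrakk>
      \<Longrightarrow> Fmor X Z (Comp C X Y Z g f)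
        = Comp D (Fobj X) (Fobj Y) (Fobj Z) (Fmor Y Z g) (Fmor X Y f)"

text \<open>Abelian groups whose elements belong to the type \<open>'a\<close>. Homomorphisms are taken to be
  undefined outside the carrier of their domain, so that equality of morphisms is equality of
  functions on that carrier.\<close>

definition Ab :: "('a monoid, 'a \<Rightarrow> 'a) category" where
  "Ab = \<lparr>Obj = {G. comm_group G},
         Hom = (\<lambda>G H. hom G H \<inter> extensional (carrier G)),
         Ident = (\<lambda>G. \<lambda>x\<in>carrier G. x),
         Comp = (\<lambda>G H K g f. compose (carrier G) g f)\<rparr>"


section \<open>Digital images\<close>

text \<open>Points of $\mathbb{Z}^d$ are the integer lists of length \<open>d\<close>.\<close>

type_synonym point = "int list"

definition Zpow :: "nat \<Rightarrow> point set" where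
  "Zpow d = {p. length p = d}"

definition c_adj :: "nat \<Rightarrow> nat \<Rightarrow> point \<Rightarrow> point \<Rightarrow> bool" where
  "c_adj d l p q \<longleftrightarrow> p \<in> Zpow d \<and> q \<in> Zpow d \<and> p \<noteq> q \<and>
     (\<forall>i<d. p ! i = q ! i \<or> \<bar>p ! i - q ! i\<bar> = 1) \<and> card {i. i < d \<and> p ! i \<noteq> q ! i} \<le> l"

record digital_image =
  points :: "point set"
  adj :: "point \<Rightarrow> point \<Rightarrow> bool"

definition is_digital_image :: "digital_image \<Rightarrow> bool" where
  "is_digital_image X \<longleftrightarrow>
     (\<exists>d\<ge>1. \<exists>l\<in>{1..d}. points X \<subseteq> Zpow d \<and> finite (points X) \<and> adj X = c_adj d l)"

definition digital_continuous :: "digital_image \<Rightarrow> digital_image \<Rightarrow> (point \<Rightarrow> point) \<Rightarrow> bool" where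
  "digital_continuous X Y f \<longleftrightarrow> f \<in> points X \<rightarrow> points Y \<and>
     (\<forall>x\<in>points X. \<forall>x'\<in>points X. adj X x x' \<longrightarrow> f x = f x' \<or> adj Y (f x) (f x'))"

definition Dig :: "(digital_image, point \<Rightarrow> point) category" where
  "Dig = \<lparr>Obj = {X. is_digital_image X},
          Hom = (\<lambda>X Y. {f. digital_continuous X Y f} \<inter> extensional (points X)),
          Ident = (\<lambda>X. \<lambda>x\<in>points X. x),
          Comp = (\<lambda>X Y Z g f. compose (points X) g f)\<rparr>"


section \<open>Digital cubes\<close>

definition Icube :: "nat \<Rightarrow> digital_image" where
  "Icube n = \<lparr>points = {t \<in> Zpow n. set t \<subseteq> {0, 1}}, adj = c_adj n 1\<rparr>"

definition digital_cubes :: "nat \<Rightarrow> digital_image \<Rightarrow> (point \<Rightarrow> point) set" where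
  "digital_cubes n X = {T. digital_continuous (Icube n) X T} \<inter> extensional (points (Icube n))"

definition degenerate_cubes :: "nat \<Rightarrow> digital_image \<Rightarrow> (point \<Rightarrow> point) set" where
  "degenerate_cubes n X = {T \<in> digital_cubes n X.
     \<exists>i<n. \<forall>t\<in>points (Icube n). \<forall>c\<in>{0, 1}. T (t[i := c]) = T t}"

text \<open>\<open>face c n i T\<close> is the \<open>(n - 1)\<close>-cube obtained from the \<open>n\<close>-cube \<open>T\<close> by inserting \<open>c\<close> as
  the \<open>i\<close>-th coordinate, counted from 1: the front face $A_i T$ for \<open>c = 0\<close> and the back face
  $B_i T$ for \<open>c = 1\<close>.\<close>

definition face :: "int \<Rightarrow> nat \<Rightarrow> nat \<Rightarrow> (point \<Rightarrow> point) \<Rightarrow> (point \<Rightarrow> point)" where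
  "face c n i T = (\<lambda>t\<in>points (Icube (n - 1)). T (take (i - 1) t @ c # drop (i - 1) t))"

definition cube_boundary :: "nat \<Rightarrow> (point \<Rightarrow> point) \<Rightarrow> ((point \<Rightarrow> point) \<Rightarrow>\<^sub>0 int)" where
  "cube_boundary n T =
     (\<Sum>i=1..n. frag_cmul ((-1) ^ i) (frag_of (face 0 n i T) - frag_of (face 1 n i T)))"


section \<open>The cubical chain complex\<close>

text \<open>The map of quotients \<open>G Mod M \<rightarrow> H Mod N\<close> induced by \<open>h\<close>, sending the coset of \<open>z\<close> to the
  coset of \<open>h z\<close>. The use of \<^const>\<open>the_elem\<close> makes this meaningful only when the result does
  not depend on the representative \<open>z\<close>.\<close>

definition quotient_map ::
  "('b, 'c) monoid_scheme \<Rightarrow> 'b set \<Rightarrow> ('a \<Rightarrow> 'b) \<Rightarrow> 'a set \<Rightarrow> 'b set" where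
  "quotient_map H N h c = the_elem ((\<lambda>z. N #>\<^bsub>H\<^esub> h z) ` c)"

text \<open>Degrees are integers; there are no generators, hence only the zero chain, in negative
  degrees.\<close>

definition dQ :: "int \<Rightarrow> digital_image \<Rightarrow> ((point \<Rightarrow> point) \<Rightarrow>\<^sub>0 int) monoid" where
  "dQ n X = free_Abelian_group {T. 0 \<le> n \<and> T \<in> digital_cubes (nat n) X}"

definition dD :: "int \<Rightarrow> digital_image \<Rightarrow> ((point \<Rightarrow> point) \<Rightarrow>\<^sub>0 int) set" where
  "dD n X = generate (dQ n X) (frag_of ` {T. 0 \<le> n \<and> T \<in> degenerate_cubes (nat n) X})"

definition dC :: "int \<Rightarrow> digital_image \<Rightarrow> ((point \<Rightarrow> point) \<Rightarrow>\<^sub>0 int) set monoid" where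
  "dC n X = dQ n X Mod dD n X"

text \<open>The boundary from degree \<open>n\<close> to degree \<open>n - 1\<close>; for \<open>n \<le> 0\<close> the sum in
  \<^const>\<open>cube_boundary\<close> is empty and the map is zero.\<close>

definition dC_boundary ::
  "int \<Rightarrow> digital_image \<Rightarrow> ((point \<Rightarrow> point) \<Rightarrow>\<^sub>0 int) set \<Rightarrow> ((point \<Rightarrow> point) \<Rightarrow>\<^sub>0 int) set" where
  "dC_boundary n X =
     quotient_map (dQ (n - 1) X) (dD (n - 1) X) (frag_extend (cube_boundary (nat n)))"

definition dC_map ::
  "int \<Rightarrow> digital_image \<Rightarrow> (point \<Rightarrow> point)
     \<Rightarrow> ((point \<Rightarrow> point) \<Rightarrow>\<^sub>0 int) set \<Rightarrow> ((point \<Rightarrow> point) \<Rightarrow>\<^sub>0 int) set" where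
  "dC_map n Y f =
     quotient_map (dQ n Y) (dD n Y)
       (frag_extend (\<lambda>T. frag_of (compose (points (Icube (nat n))) f T)))"


section \<open>Cubical singular homology\<close>

definition dZ :: "int \<Rightarrow> digital_image \<Rightarrow> ((point \<Rightarrow> point) \<Rightarrow>\<^sub>0 int) set monoid" where
  "dZ n X = (dC n X)\<lparr>carrier := kernel (dC n X) (dC (n - 1) X) (dC_boundary n X)\<rparr>"

definition dB :: "int \<Rightarrow> digital_image \<Rightarrow> ((point \<Rightarrow> point) \<Rightarrow>\<^sub>0 int) set set" where
  "dB n X = dC_boundary (n + 1) X ` carrier (dC (n + 1) X)"

definition dH :: "int \<Rightarrow> digital_image \<Rightarrow> ((point \<Rightarrow> point) \<Rightarrow>\<^sub>0 int) set set monoid" where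
  "dH n X = dZ n X Mod dB n X"

definition dH_map ::
  "int \<Rightarrow> digital_image \<Rightarrow> digital_image \<Rightarrow> (point \<Rightarrow> point)
     \<Rightarrow> ((point \<Rightarrow> point) \<Rightarrow>\<^sub>0 int) set set \<Rightarrow> ((point \<Rightarrow> point) \<Rightarrow>\<^sub>0 int) set set" where
  "dH_map n X Y f = restrict (quotient_map (dZ n Y) (dB n Y) (dC_map n Y f)) (carrier (dH n X))"

end

theory Submission
  imports Defs
begin

text \<open>Every face of a cube that is degenerate in direction \<open>k\<close> is degenerate again, except the two
  faces in direction \<open>k\<close>, which coincide and cancel in the boundary. Hence the boundary passes to
  the quotient by degenerate chains, and so does composition with a continuous map, which preserves
  degeneracy and commutes with taking faces. Two successive boundaries cancel because, for
  \<open>j < i\<close>, the \<open>j\<close>-th face of the \<open>i\<close>-th face is the \<open>(i - 1)\<close>-th face of the \<open>j\<close>-th face, with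
  opposite sign. Functoriality already holds for cubes and is inherited by each quotient.\<close>

section \<open>Induced maps of quotient groups\<close>

context group_hom
begin

text \<open>Two representatives of a coset differ by some \<open>m\<close> in \<open>M\<close>, and
  \<open>h m\<close> lies in \<open>N\<close>, so both give the same coset of \<open>N\<close>. This
  removes \<open>the_elem\<close> from all later computations.\<close>

lemma quotient_map_coset:
  assumes M: "subgroup M G" and N: "subgroup N H" and sub: "h ` M \<subseteq> N" and z: "z \<in> carrier G"
  shows "quotient_map H N h (M #>\<^bsub>G\<^esub> z) = N #>\<^bsub>H\<^esub> h z"
proof -
  have "N #>\<^bsub>H\<^esub> h w = N #>\<^bsub>H\<^esub> h z" if w: "w \<in> M #>\<^bsub>G\<^esub> z" for w
  proof -
    obtain m where m: "m \<in> M" "w = m \<otimes>\<^bsub>G\<^esub> z"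
      using w by (auto simp: r_coset_def)
    have "h w = h m \<otimes>\<^bsub>H\<^esub> h z" "h m \<in> N"
      using m z sub subgroup.mem_carrier[OF M] by auto
    then have "h w \<in> N #>\<^bsub>H\<^esub> h z"
      by (auto simp: r_coset_def)
    then show ?thesis
      using H.repr_independence[OF _ _ N] z by simp
  qed
  \<comment> \<open>The coset is nonempty, so the image below is a singleton rather than
    empty.\<close>
  moreover have "z \<in> M #>\<^bsub>G\<^esub> z"
    by (rule G.rcos_self[OF z M])
  ultimately have "(\<lambda>w. N #>\<^bsub>H\<^esub> h w) ` (M #>\<^bsub>G\<^esub> z) = {N #>\<^bsub>H\<^esub> h z}"
    by blast
  then show ?thesis
    by (simp add: quotient_map_def)
qed

lemma quotient_map_hom:
  assumes M: "M \<lhd> G" and N: "N \<lhd> H" and sub: "h ` M \<subseteq> N"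
  shows "quotient_map H N h \<in> hom (G Mod M) (H Mod N)"
proof -
  note coset = quotient_map_coset[OF normal_imp_subgroup[OF M] normal_imp_subgroup[OF N] sub]
  show ?thesis
    by (rule homI) (auto simp: carrier_FactGroup coset normal.rcos_sum[OF M] normal.rcos_sum[OF N])
qed

end


section \<open>Free abelian groups\<close>

lemma frag_cmul_diff_distrib2: "frag_cmul c (a - b) = frag_cmul c a - frag_cmul c b"
  by (rule poly_mapping_eqI) (simp add: lookup_minus algebra_simps)

text \<open>Reduces chain identities, such as the vanishing of the double boundary or the chain map
  law, to identities on single cubes.\<close>

lemma frag_extend_frag_extend:
  "frag_extend f (frag_extend g c) = frag_extend (\<lambda>x. frag_extend f (g x)) c"
  unfolding frag_extend_def[of g] frag_extend_def[of "\<lambda>x. frag_extend f (g x)"]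
  by (simp add: frag_extend_sum frag_extend_cmul)

lemma frag_extend_hom:
  assumes "\<And>x. x \<in> S \<Longrightarrow> f x \<in> carrier (free_Abelian_group S')"
  shows "frag_extend f \<in> hom (free_Abelian_group S) (free_Abelian_group S')"
proof (rule homI)
  fix c assume "c \<in> carrier (free_Abelian_group S)"
  then show "frag_extend f c \<in> carrier (free_Abelian_group S')"
    using keys_frag_extend[of f c] assms by fastforce
qed (simp add: frag_extend_add)

text \<open>A homomorphism carries a generated subgroup to the subgroup generated by the images.
  Hence a map preserves degenerate chains as soon as it does so on degenerate cubes.\<close>

lemma frag_extend_generate_subset:
  assumes f: "\<And>x. x \<in> S \<Longrightarrow> f x \<in> carrier (free_Abelian_group S')"
    and D: "D \<subseteq> S" and K: "subgroup K (free_Abelian_group S')" and fD: "\<And>x. x \<in> D \<Longrightarrow> f x \<in> K"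
  shows "frag_extend f ` generate (free_Abelian_group S) (frag_of ` D) \<subseteq> K"
proof -
  interpret group_hom "free_Abelian_group S" "free_Abelian_group S'" "frag_extend f"
    using frag_extend_hom[of S f S', OF f] by (simp add: group_hom_def group_hom_axioms_def)
  have "frag_of ` D \<subseteq> carrier (free_Abelian_group S)"
    using D by auto
  then have "frag_extend f ` generate (free_Abelian_group S) (frag_of ` D)
      = generate (free_Abelian_group S') (frag_extend f ` frag_of ` D)"
    by (rule generate_img[symmetric])
  also have "\<dots> \<subseteq> K"
    using fD by (intro H.generate_subgroup_incl K) auto
  finally show ?thesis .
qed

lemma subgroup_free_Abelian_group_cmul:
  assumes K: "subgroup K (free_Abelian_group S)" and x: "x \<in> K"
  shows "frag_cmul k x \<in> K"
proof -
  \<comment> \<open>Membership in the carrier lets the integer power of \<open>x\<close> in the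
    group be read as \<open>frag_cmul\<close>.\<close>
  have "Poly_Mapping.keys x \<subseteq> S"
    using subgroup.mem_carrier[OF K x] by simp
  then show ?thesis
    using group.subgroup_int_pow_closed[OF group_free_Abelian_group K x, of k] by simp
qed

lemma subgroup_free_Abelian_group_diff:
  assumes K: "subgroup K (free_Abelian_group S)" and x: "x \<in> K" and y: "y \<in> K"
  shows "x - y \<in> K"
  using subgroup.m_closed[OF K x subgroup_free_Abelian_group_cmul[OF K y, of "-1"]] by simp

lemma subgroup_free_Abelian_group_sum:
  assumes K: "subgroup K (free_Abelian_group S)" and "\<And>i. i \<in> A \<Longrightarrow> g i \<in> K"
  shows "sum g A \<in> K"
  using assms(2)
proof (induction A rule: infinite_finite_induct)
  case (insert x F)
  then show ?case
    using subgroup.m_closed[OF K, of "g x" "sum g F"] by simp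
qed (use subgroup.one_closed[OF K] in auto)

text \<open>A pair (i, j) with j < i is matched with (j, i - 1): the entries agree by hypothesis,
  while the index sum drops by one and flips the sign. These matches exhaust the index
  rectangle.\<close>

lemma alternating_double_sum_zero:
  fixes g :: "nat \<Rightarrow> nat \<Rightarrow> ('a \<Rightarrow>\<^sub>0 int)"
  assumes g: "\<And>i j. \<lbrakk>1 \<le> j; j < i; i \<le> n\<rbrakk> \<Longrightarrow> g i j = g j (i - 1)"
  shows "(\<Sum>i=1..n. \<Sum>j=1..n - 1. frag_cmul ((-1) ^ (i + j)) (g i j)) = 0"
proof -
  let ?t = "\<lambda>(i, j). frag_cmul ((-1) ^ (i + j)) (g i j)"
  let ?A = "{1..n} \<times> {1..n - 1}"
  let ?L = "{(i, j) \<in> ?A. j < i}" and ?U = "{(i, j) \<in> ?A. i \<le> j}"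
  have "sum ?t ?A = sum ?t (?L \<union> ?U)"
    by (rule sum.cong) auto
  also have "\<dots> = sum ?t ?L + sum ?t ?U"
    by (rule sum.union_disjoint) (auto intro: finite_subset[of _ ?A])
  also have "sum ?t ?L = (\<Sum>p\<in>?U. - ?t p)"
  proof (rule sum.reindex_bij_witness[where i="\<lambda>(i, j). (j + 1, i)" and j="\<lambda>(i, j). (j, i - 1)"])
    fix p assume p: "p \<in> ?L"
    \<comment> \<open>Writing the first index as a successor makes the subtraction of one
      exact.\<close>
    then obtain i j where ij: "p = (Suc i, j)" "1 \<le> j" "j < Suc i" "Suc i \<le> n"
      by (cases p; cases "fst p") auto
    then show "- ?t ((\<lambda>(i, j). (j, i - 1)) p) = ?t p"
      using g[of j "Suc i"] by (simp add: add.commute)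
  qed auto
  finally show ?thesis
    by (simp add: sum.cartesian_product sum_negf)
qed


section \<open>Faces of digital cubes\<close>

definition insert_at :: "nat \<Rightarrow> 'a \<Rightarrow> 'a list \<Rightarrow> 'a list" where
  "insert_at k c t = take k t @ c # drop k t"

lemma length_insert_at [simp]: "length (insert_at k c t) = Suc (length t)"
  by (simp add: insert_at_def)

lemma set_insert_at [simp]: "set (insert_at k c t) = insert c (set t)"
  by (metis append_take_drop_id insert_at_def list.simps(15) set_append Un_insert_right)

lemma nth_insert_at:
  assumes "k \<le> length t" "j \<le> length t"
  shows "insert_at k c t ! j = (if j < k then t ! j else if j = k then c else t ! (j - 1))"
proof (cases "j \<le> k")
  case True
  then show ?thesis
    using assms by (auto simp: insert_at_def nth_append)
next
  case False
  then obtain m where "j = Suc (k + m)"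
    using less_iff_Suc_add[of k j] by auto
  then show ?thesis
    using assms by (simp add: insert_at_def nth_append)
qed

text \<open>Inserting at or before position \<open>k\<close> moves that position to
  \<open>Suc k\<close>. On points, this is the cubical identity behind
  \<open>face_face\<close>.\<close>

lemma insert_at_commute:
  assumes "j \<le> k" "k \<le> length t"
  shows "insert_at (Suc k) d (insert_at j c t) = insert_at j c (insert_at k d t)"
  using assms by (intro nth_equalityI) (auto simp: nth_insert_at)

lemma list_update_insert_at_same:
  assumes "k \<le> length t"
  shows "(insert_at k c t)[k := d] = insert_at k d t"
  using assms by (intro nth_equalityI) (auto simp: nth_insert_at nth_list_update)

text \<open>Coordinates before an insertion keep their position, the others shift by one (next
  lemma). The two cases locate the constant coordinate in a face of a degenerate cube.\<close>

lemma list_update_insert_at_less: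
  assumes "k < j" "j \<le> length t"
  shows "(insert_at j c t)[k := d] = insert_at j c (t[k := d])"
  using assms by (intro nth_equalityI) (auto simp: nth_insert_at nth_list_update)

lemma list_update_insert_at_greater:
  assumes "j \<le> k" "k < length t"
  shows "(insert_at j c t)[Suc k := d] = insert_at j c (t[k := d])"
  using assms by (intro nth_equalityI) (auto simp: nth_insert_at nth_list_update)

section \<open>Faces and degeneracy\<close>

lemma points_Icube_iff: "t \<in> points (Icube n) \<longleftrightarrow> length t = n \<and> set t \<subseteq> {0, 1}"
  by (simp add: Icube_def Zpow_def)

lemma adj_Icube [simp]: "adj (Icube n) = c_adj n 1"
  by (simp add: Icube_def)

lemma list_update_Icube:
  "\<lbrakk>t \<in> points (Icube n); c \<in> {0, 1}\<rbrakk> \<Longrightarrow> t[i := c] \<in> points (Icube n)"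
  using set_update_subset_insert[of t i c] by (auto simp: points_Icube_iff)

lemma insert_at_Icube:
  assumes "t \<in> points (Icube (n - 1))" "c \<in> {0, 1}" "1 \<le> n"
  shows "insert_at k c t \<in> points (Icube n)"
  using assms by (auto simp: points_Icube_iff)

text \<open>The inserted coordinate is the same in both points, so every position where the longer
  lists differ comes from one where \<open>t\<close> and \<open>t'\<close> differ, shifted past
  \<open>k\<close> if necessary. The count cannot grow.\<close>

lemma c_adj_insert_at:
  assumes adj: "c_adj d l t t'" and k: "k \<le> d"
  shows "c_adj (Suc d) l (insert_at k c t) (insert_at k c t')"
proof -
  have len: "length t = d" "length t' = d" and ne: "t \<noteq> t'"
    and near: "\<And>i. i < d \<Longrightarrow> t ! i = t' ! i \<or> \<bar>t ! i - t' ! i\<bar> = 1"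
    and card: "card {i. i < d \<and> t ! i \<noteq> t' ! i} \<le> l"
    using adj by (auto simp: c_adj_def Zpow_def)
  let ?u = "insert_at k c t" and ?u' = "insert_at k c t'"
  have nth: "?u ! i = (if i < k then t ! i else if i = k then c else t ! (i - 1))"
       "?u' ! i = (if i < k then t' ! i else if i = k then c else t' ! (i - 1))" if "i < Suc d" for i
    using nth_insert_at[of k t i c] nth_insert_at[of k t' i c] that k len by simp_all
  have "{i. i < Suc d \<and> ?u ! i \<noteq> ?u' ! i}
      \<subseteq> (\<lambda>i. if i < k then i else Suc i) ` {i. i < d \<and> t ! i \<noteq> t' ! i}"
  proof
    fix i assume "i \<in> {i. i < Suc d \<and> ?u ! i \<noteq> ?u' ! i}"
    then have i: "i < Suc d" "?u ! i \<noteq> ?u' ! i" by auto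
    show "i \<in> (\<lambda>i. if i < k then i else Suc i) ` {i. i < d \<and> t ! i \<noteq> t' ! i}"
    proof (cases "i < k")
      case True
      then show ?thesis using i k nth[of i] by (intro image_eqI[of _ _ i]) auto
    next
      case False
      then show ?thesis using i k nth[of i]
        by (intro image_eqI[of _ _ "i - 1"]) (auto split: if_splits)
    qed
  qed
  then have "card {i. i < Suc d \<and> ?u ! i \<noteq> ?u' ! i} \<le> card {i. i < d \<and> t ! i \<noteq> t' ! i}"
    by (rule surj_card_le[rotated]) simp
  moreover have "?u ! i = ?u' ! i \<or> \<bar>?u ! i - ?u' ! i\<bar> = 1" if "i < Suc d" for i
    using near[of i] near[of "i - 1"] nth[of i] that k by auto
  \<comment> \<open>Equal insertions would have equal parts before and after position
    \<open>k\<close>, and these parts determine the list.\<close>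
  moreover have "?u \<noteq> ?u'"
    using ne len by (auto simp: insert_at_def) (metis append_take_drop_id)
  ultimately show ?thesis
    using card len by (auto simp: c_adj_def Zpow_def)
qed

text \<open>Directions of \<open>face\<close> count from 1, positions of \<open>insert_at\<close>
  from 0.\<close>

lemma face_eq: "face c n i T = (\<lambda>t\<in>points (Icube (n - 1)). T (insert_at (i - 1) c t))"
  by (simp add: face_def insert_at_def)

text \<open>A face is \<open>T\<close> after an insertion map, which sends the smaller cube into the
  larger one and preserves adjacency.\<close>

lemma face_in_digital_cubes:
  assumes T: "T \<in> digital_cubes n X" and i: "1 \<le> i" "i \<le> n" and c: "c \<in> {0, 1}"
  shows "face c n i T \<in> digital_cubes (n - 1) X"
proof -
  let ?P = "points (Icube (n - 1))" and ?ins = "insert_at (i - 1) c"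
  have ins: "?ins t \<in> points (Icube n)" if "t \<in> ?P" for t
    using insert_at_Icube[OF that c] i by simp
  have adj: "c_adj n 1 (?ins t) (?ins t')" if "c_adj (n - 1) 1 t t'" for t t'
    using c_adj_insert_at[OF that, of "i - 1" c] i by simp
  have T_points: "T \<in> points (Icube n) \<rightarrow> points X"
    and T_adj: "\<And>s s'. \<lbrakk>s \<in> points (Icube n); s' \<in> points (Icube n); c_adj n 1 s s'\<rbrakk>
      \<Longrightarrow> T s = T s' \<or> adj X (T s) (T s')"
    using T by (auto simp: digital_cubes_def digital_continuous_def)
  show ?thesis
    using T_points T_adj ins adj
    by (auto simp: digital_cubes_def digital_continuous_def face_eq Pi_iff)
qed

lemma face_face:
  assumes "1 \<le> j" "j < i" "i \<le> n" "c \<in> {0, 1}" "d \<in> {0, 1}"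
  shows "face c (n - 1) j (face d n i T) = face d (n - 1) (i - 1) (face c n j T)"
proof
  fix t
  show "face c (n - 1) j (face d n i T) t = face d (n - 1) (i - 1) (face c n j T) t"
  proof (cases "t \<in> points (Icube (n - 1 - 1))")
    case True
    have len: "length t = n - 2"
      using True by (simp add: points_Icube_iff)
    have "insert_at (j - 1) c t \<in> points (Icube (n - 1))"
      "insert_at (i - 1 - 1) d t \<in> points (Icube (n - 1))"
      using insert_at_Icube[OF True] assms by auto
    \<comment> \<open>\<open>Suc (i - 2)\<close> is the position of direction \<open>i\<close>; from
      j < i follows j - 1 \<le> i - 2, as the commutation requires.\<close>
    moreover have "insert_at (Suc (i - 2)) d (insert_at (j - 1) c t)
        = insert_at (j - 1) c (insert_at (i - 2) d t)"
      using assms len by (intro insert_at_commute) auto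
    moreover have "Suc (i - 2) = i - 1" "i - 1 - 1 = i - 2"
      using assms by auto
    ultimately show ?thesis
      using True by (simp add: face_eq)
  \<comment> \<open>Off the cube of dimension \<open>n - 1 - 1\<close> both sides are
    \<open>undefined\<close>.\<close>
  qed (simp add: face_eq)
qed

text \<open>An elimination rule exposing the degenerate direction, so that the boundary can be
  treated summand by summand. Degeneracy counts coordinates from 0, so position \<open>k\<close> of
  the proof is direction \<open>Suc k\<close>.\<close>

lemma face_degenerate:
  assumes T: "T \<in> degenerate_cubes n X"
  obtains k where "k \<in> {1..n}" "face 0 n k T = face 1 n k T"
    "\<And>i c. \<lbrakk>i \<in> {1..n}; i \<noteq> k; c \<in> {0, 1}\<rbrakk> \<Longrightarrow> face c n i T \<in> degenerate_cubes (n - 1) X"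
proof -
  obtain k where cube: "T \<in> digital_cubes n X" and k: "k < n"
    and const: "\<And>t c. \<lbrakk>t \<in> points (Icube n); c \<in> {0, 1}\<rbrakk> \<Longrightarrow> T (t[k := c]) = T t"
    using T unfolding degenerate_cubes_def by blast
  have "T (insert_at k 0 t) = T (insert_at k 1 t)" if t: "t \<in> points (Icube (n - 1))" for t
  proof -
    have "k \<le> length t"
      using t k by (simp add: points_Icube_iff)
    then show ?thesis
      using const[of "insert_at k 1 t" 0] insert_at_Icube[OF t, of 1 k] k
      by (simp add: list_update_insert_at_same)
  qed
  then have faces: "face 0 n (Suc k) T = face 1 n (Suc k) T"
    by (auto simp: face_eq intro: restrict_ext)
  have "face c n i T \<in> degenerate_cubes (n - 1) X"
    if i: "i \<in> {1..n}" "i \<noteq> Suc k" and c: "c \<in> {0, 1}" for i c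
  proof -
    \<comment> \<open>The constant coordinate as seen in the face: its position is lowered by one if
      it lies after the coordinate fixed by the face.\<close>
    define k' where "k' = (if k < i - 1 then k else k - 1)"
    have k': "k' < n - 1"
      using i k by (auto simp: k'_def)
    have "face c n i T (t[k' := d]) = face c n i T t"
      if t: "t \<in> points (Icube (n - 1))" and d: "d \<in> {0, 1}" for t d
    proof -
      have len: "length t = n - 1"
        using t by (simp add: points_Icube_iff)
      have "insert_at (i - 1) c (t[k' := d]) = (insert_at (i - 1) c t)[k := d]"
      proof (cases "k < i - 1")
        case True
        then show ?thesis
          using i len list_update_insert_at_less[of k "i - 1" t c d] by (auto simp: k'_def)
      next
        case False
        \<comment> \<open>The case k = i - 1 is excluded by \<open>i \<noteq> Suc k\<close>, so
          \<open>k\<close> is positive.\<close>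
        then obtain m where "k = Suc m" "i - 1 \<le> m"
          using i by (cases k) auto
        then show ?thesis
          using k len by (simp add: k'_def list_update_insert_at_greater)
      qed
      then show ?thesis
        using const[OF insert_at_Icube[OF t c] d] list_update_Icube[OF t d] t k
        by (simp add: face_eq)
    qed
    then show ?thesis
      using face_in_digital_cubes[OF cube _ _ c, of i] i k' by (auto simp: degenerate_cubes_def)
  qed
  with faces k that[of "Suc k"] show ?thesis
    by simp
qed

section \<open>Composition of cubes with maps\<close>

lemma face_compose:
  assumes "1 \<le> i" "i \<le> n" "c \<in> {0, 1}"
  shows "face c n i (compose (points (Icube n)) f T)
    = compose (points (Icube (n - 1))) f (face c n i T)"
  using assms insert_at_Icube[of _ n c "i - 1"]
  by (auto simp: face_eq compose_def fun_eq_iff)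

lemma compose_in_digital_cubes:
  assumes "T \<in> digital_cubes n X" "digital_continuous X Y f"
  shows "compose (points (Icube n)) f T \<in> digital_cubes n Y"
  using assms
  by (auto simp: digital_cubes_def digital_continuous_def compose_def Pi_iff) metis

lemma compose_in_degenerate_cubes:
  assumes T: "T \<in> degenerate_cubes n X" and f: "digital_continuous X Y f"
  shows "compose (points (Icube n)) f T \<in> degenerate_cubes n Y"
proof -
  obtain i where "T \<in> digital_cubes n X" "i < n"
    "\<And>t c. \<lbrakk>t \<in> points (Icube n); c \<in> {0, 1}\<rbrakk> \<Longrightarrow> T (t[i := c]) = T t"
    using T unfolding degenerate_cubes_def by blast
  then show ?thesis
    using compose_in_digital_cubes[OF _ f] list_update_Icube
    by (auto simp: degenerate_cubes_def compose_eq)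
qed

lemma compose_id_cube:
  assumes "T \<in> digital_cubes n X"
  shows "compose (points (Icube n)) (\<lambda>x\<in>points X. x) T = T"
  using assms
  by (intro extensionalityI[of _ "points (Icube n)"])
     (auto simp: digital_cubes_def digital_continuous_def compose_eq)

text \<open>\<open>T\<close> takes values in \<open>points X\<close>, where the restricted composite
  of \<open>g\<close> and \<open>f\<close> agrees with the plain one.\<close>

lemma compose_compose_cube:
  assumes "T \<in> digital_cubes n X"
  shows "compose (points (Icube n)) (compose (points X) g f) T
    = compose (points (Icube n)) g (compose (points (Icube n)) f T)"
  using assms
  by (auto simp: digital_cubes_def digital_continuous_def compose_def fun_eq_iff Pi_iff)


section \<open>The boundary of a cube\<close>

lemma boundary_cube_boundary: "frag_extend (cube_boundary (n - 1)) (cube_boundary n T) = 0"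
proof -
  \<comment> \<open>The four double faces for directions \<open>i\<close> and \<open>j\<close>, with
    the signs from the two differences; the powers of -1 stay outside.\<close>
  define g where "g i j =
      (frag_of (face 0 (n - 1) j (face 0 n i T)) - frag_of (face 1 (n - 1) j (face 0 n i T)))
    - (frag_of (face 0 (n - 1) j (face 1 n i T)) - frag_of (face 1 (n - 1) j (face 1 n i T)))" for i j
  have "frag_extend (cube_boundary (n - 1)) (cube_boundary n T) =
      (\<Sum>i=1..n. frag_cmul ((-1) ^ i)
        (cube_boundary (n - 1) (face 0 n i T) - cube_boundary (n - 1) (face 1 n i T)))"
    unfolding cube_boundary_def[of n T]
    by (simp add: frag_extend_sum frag_extend_cmul frag_extend_diff)
  also have "\<dots> = (\<Sum>i=1..n. \<Sum>j=1..n - 1. frag_cmul ((-1) ^ (i + j)) (g i j))"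
    unfolding cube_boundary_def g_def
    by (simp add: sum_subtractf[symmetric] frag_cmul_diff_distrib2[symmetric] frag_cmul_sum power_add)
  \<comment> \<open>Passing from (i, j) to (j, i - 1), \<open>face_face\<close> matches the
    front-front and back-back terms and interchanges the two mixed terms, which carry the same
    sign.\<close>
  also have "\<dots> = 0"
    by (rule alternating_double_sum_zero) (simp add: g_def face_face[unfolded One_nat_def] algebra_simps)
  finally show ?thesis .
qed

lemma cube_boundary_compose:
  "cube_boundary n (compose (points (Icube n)) f T)
    = frag_extend (\<lambda>T. frag_of (compose (points (Icube (n - 1))) f T)) (cube_boundary n T)"
  unfolding cube_boundary_def
  by (simp add: frag_extend_sum frag_extend_cmul frag_extend_diff face_compose)


section \<open>The chain complex\<close>

lemma comm_group_dQ: "comm_group (dQ n X)"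
  by (simp add: dQ_def abelian_free_Abelian_group)

lemma group_dQ: "group (dQ n X)"
  by (simp add: dQ_def)

lemma carrier_dQ: "z \<in> carrier (dQ n X) \<longleftrightarrow>
    Poly_Mapping.keys z \<subseteq> {T. 0 \<le> n \<and> T \<in> digital_cubes (nat n) X}"
  by (simp add: dQ_def)

lemma degenerate_cubes_subset:
  "{T. 0 \<le> n \<and> T \<in> degenerate_cubes (nat n) X} \<subseteq> {T. 0 \<le> n \<and> T \<in> digital_cubes (nat n) X}"
  by (auto simp: degenerate_cubes_def)

lemma subgroup_dD: "subgroup (dD n X) (dQ n X)"
  unfolding dD_def
  using degenerate_cubes_subset[of n X]
  by (intro group.generate_is_subgroup[OF group_dQ]) (auto simp: carrier_dQ)

lemma normal_dD: "dD n X \<lhd> dQ n X"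
  using comm_group.subgroup_imp_normal[OF comm_group_dQ subgroup_dD] .

lemma degenerate_in_dD:
  "\<lbrakk>0 \<le> n; T \<in> degenerate_cubes (nat n) X\<rbrakk> \<Longrightarrow> frag_of T \<in> dD n X"
  unfolding dD_def by (auto intro: generate.incl)

lemma comm_group_dC: "comm_group (dC n X)"
  unfolding dC_def by (rule comm_group.abelian_FactGroup[OF comm_group_dQ subgroup_dD])

lemma group_dC: "group (dC n X)"
  using comm_group_dC by (rule comm_group.axioms(2))

lemma carrier_dC: "carrier (dC n X) = (\<lambda>z. dD n X #>\<^bsub>dQ n X\<^esub> z) ` carrier (dQ n X)"
  by (simp add: dC_def carrier_FactGroup)

lemma one_dC: "\<one>\<^bsub>dC n X\<^esub> = dD n X"
  by (simp add: dC_def)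

section \<open>The boundary modulo degenerate chains\<close>

lemma cube_boundary_in_dQ:
  assumes "0 \<le> n" "T \<in> digital_cubes (nat n) X"
  shows "cube_boundary (nat n) T \<in> carrier (dQ (n - 1) X)"
proof -
  \<comment> \<open>The whole carrier is taken as a subgroup, so that the closure lemmas for sums,
    multiples and differences apply.\<close>
  have K: "subgroup (carrier (dQ (n - 1) X))
      (free_Abelian_group {T. 0 \<le> n - 1 \<and> T \<in> digital_cubes (nat (n - 1)) X})"
    unfolding dQ_def by (intro group.subgroup_self) simp
  \<comment> \<open>An index \<open>i\<close> exists only for n \<ge> 1, where degree
    \<open>n - 1\<close> is nonnegative; for n = 0 the sum is empty.\<close>
  have "frag_of (face c (nat n) i T) \<in> carrier (dQ (n - 1) X)"
    if "i \<in> {1..nat n}" "c \<in> {0, 1}" for i c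
    using face_in_digital_cubes[OF assms(2) _ _ that(2), of i] that(1)
    by (auto simp: carrier_dQ nat_diff_distrib)
  then show ?thesis
    unfolding cube_boundary_def
    by (intro subgroup_free_Abelian_group_sum[OF K] subgroup_free_Abelian_group_cmul[OF K]
        subgroup_free_Abelian_group_diff[OF K]) auto
qed

lemma cube_boundary_degenerate:
  assumes "0 \<le> n" "T \<in> degenerate_cubes (nat n) X"
  shows "cube_boundary (nat n) T \<in> dD (n - 1) X"
proof -
  have K: "subgroup (dD (n - 1) X)
      (free_Abelian_group {T. 0 \<le> n - 1 \<and> T \<in> digital_cubes (nat (n - 1)) X})"
    using subgroup_dD[of "n - 1" X] by (simp add: dQ_def)
  obtain k where eq: "face 0 (nat n) k T = face 1 (nat n) k T"
    and deg: "\<And>i c. \<lbrakk>i \<in> {1..nat n}; i \<noteq> k; c \<in> {0, 1}\<rbrakk>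
      \<Longrightarrow> face c (nat n) i T \<in> degenerate_cubes (nat n - 1) X"
    using face_degenerate[OF assms(2)] by blast
  have "frag_of (face 0 (nat n) i T) - frag_of (face 1 (nat n) i T) \<in> dD (n - 1) X"
    if i: "i \<in> {1..nat n}" for i
  proof (cases "i = k")
    case True
    \<comment> \<open>The two faces cancel, and the zero chain is the unit of the group.\<close>
    then show ?thesis
      using eq subgroup.one_closed[OF K] by simp
  next
    case False
    have "0 \<le> n - 1" "nat (n - 1) = nat n - 1"
      using i by auto
    then show ?thesis
      using deg[OF i False] by (intro subgroup_free_Abelian_group_diff[OF K] degenerate_in_dD) auto
  qed
  then show ?thesis
    unfolding cube_boundary_def
    by (intro subgroup_free_Abelian_group_sum[OF K] subgroup_free_Abelian_group_cmul[OF K])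
qed

lemma group_hom_boundary:
  "group_hom (dQ n X) (dQ (n - 1) X) (frag_extend (cube_boundary (nat n)))"
  using frag_extend_hom[of "{T. 0 \<le> n \<and> T \<in> digital_cubes (nat n) X}" "cube_boundary (nat n)"
      "{T. 0 \<le> n - 1 \<and> T \<in> digital_cubes (nat (n - 1)) X}"] cube_boundary_in_dQ[of n _ X]
  by (auto simp: group_hom_def group_hom_axioms_def dQ_def)

lemma boundary_dD: "frag_extend (cube_boundary (nat n)) ` dD n X \<subseteq> dD (n - 1) X"
  unfolding dD_def[of n] dQ_def[of n]
proof (rule frag_extend_generate_subset)
  show "subgroup (dD (n - 1) X)
      (free_Abelian_group {T. 0 \<le> n - 1 \<and> T \<in> digital_cubes (nat (n - 1)) X})"
    using subgroup_dD[of "n - 1" X] by (simp add: dQ_def)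
qed (use cube_boundary_in_dQ[of n _ X] cube_boundary_degenerate degenerate_cubes_subset
      in \<open>auto simp: dQ_def\<close>)

lemma dC_boundary_hom: "dC_boundary n X \<in> hom (dC n X) (dC (n - 1) X)"
  unfolding dC_boundary_def dC_def
  by (rule group_hom.quotient_map_hom[OF group_hom_boundary normal_dD normal_dD boundary_dD])

lemma dC_boundary_coset:
  "z \<in> carrier (dQ n X) \<Longrightarrow> dC_boundary n X (dD n X #>\<^bsub>dQ n X\<^esub> z)
    = dD (n - 1) X #>\<^bsub>dQ (n - 1) X\<^esub> frag_extend (cube_boundary (nat n)) z"
  unfolding dC_boundary_def
  by (rule group_hom.quotient_map_coset[OF group_hom_boundary subgroup_dD subgroup_dD boundary_dD])

lemma dC_boundary_boundary:
  assumes "c \<in> carrier (dC n X)"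
  shows "dC_boundary (n - 1) X (dC_boundary n X c) = \<one>\<^bsub>dC (n - 1 - 1) X\<^esub>"
proof -
  obtain z where z: "z \<in> carrier (dQ n X)" and c: "c = dD n X #>\<^bsub>dQ n X\<^esub> z"
    using assms by (auto simp: carrier_dC)
  \<comment> \<open>True for every integer: for n \<le> 0 both sides are 0, since subtraction of
    naturals truncates.\<close>
  have "nat (n - 1) = nat n - 1"
    by simp
  then have "frag_extend (cube_boundary (nat (n - 1))) (frag_extend (cube_boundary (nat n)) z) = 0"
    by (simp only: frag_extend_frag_extend boundary_cube_boundary frag_extend_eq_0)
  moreover have "frag_extend (cube_boundary (nat n)) z \<in> carrier (dQ (n - 1) X)"
    using group_hom.hom_closed[OF group_hom_boundary z] .
  \<comment> \<open>The coset of the zero chain is the unit of the quotient.\<close>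
  moreover have "dD (n - 1 - 1) X #>\<^bsub>dQ (n - 1 - 1) X\<^esub> 0 = dD (n - 1 - 1) X"
    using group.coset_mult_one[OF group_dQ subgroup.subset[OF subgroup_dD], of "n - 1 - 1" X]
    by (simp add: dQ_def)
  ultimately show ?thesis
    by (simp add: c dC_boundary_coset z one_dC)
qed

text \<open>The map induced by \<open>f\<close> on all cubical chains, before degenerate ones are
  divided out.\<close>

definition dQ_map :: "nat \<Rightarrow> (point \<Rightarrow> point) \<Rightarrow> ((point \<Rightarrow> point) \<Rightarrow>\<^sub>0 int) \<Rightarrow> ((point \<Rightarrow> point) \<Rightarrow>\<^sub>0 int)"
  where "dQ_map n f = frag_extend (\<lambda>T. frag_of (compose (points (Icube n)) f T))"

lemma dC_map_eq: "dC_map n Y f = quotient_map (dQ n Y) (dD n Y) (dQ_map (nat n) f)"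
  by (simp add: dC_map_def dQ_map_def)

lemma dQ_map_id:
  assumes "z \<in> carrier (dQ n X)"
  shows "dQ_map (nat n) (\<lambda>x\<in>points X. x) z = z"
proof -
  \<comment> \<open>Each cube in \<open>z\<close> is fixed, which leaves the linear extension of
    \<open>frag_of\<close>, the identity.\<close>
  have "dQ_map (nat n) (\<lambda>x\<in>points X. x) z = frag_extend frag_of z"
    using assms unfolding dQ_map_def carrier_dQ
    by (intro frag_extend_eq) (auto simp: compose_id_cube)
  then show ?thesis
    by (simp flip: frag_expansion)
qed

lemma dQ_map_compose:
  assumes "z \<in> carrier (dQ n X)"
  shows "dQ_map (nat n) (compose (points X) g f) z = dQ_map (nat n) g (dQ_map (nat n) f z)"
  using assms unfolding dQ_map_def carrier_dQ frag_extend_frag_extend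
  by (intro frag_extend_eq) (auto simp: compose_compose_cube)

lemma boundary_dQ_map:
  "frag_extend (cube_boundary n) (dQ_map n f z) = dQ_map (n - 1) f (frag_extend (cube_boundary n) z)"
  by (simp add: dQ_map_def frag_extend_frag_extend cube_boundary_compose)

section \<open>Induced maps on the quotient complex\<close>

context
  fixes X Y :: digital_image and f :: "point \<Rightarrow> point"
  assumes f: "digital_continuous X Y f"
begin

lemma group_hom_dQ_map: "group_hom (dQ n X) (dQ n Y) (dQ_map (nat n) f)"
  unfolding dQ_map_def
  using frag_extend_hom[of "{T. 0 \<le> n \<and> T \<in> digital_cubes (nat n) X}"
      "\<lambda>T. frag_of (compose (points (Icube (nat n))) f T)"
      "{T. 0 \<le> n \<and> T \<in> digital_cubes (nat n) Y}"] compose_in_digital_cubes[OF _ f]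
  by (auto simp: group_hom_def group_hom_axioms_def dQ_def)

lemma dQ_map_dD: "dQ_map (nat n) f ` dD n X \<subseteq> dD n Y"
  unfolding dD_def[of n X] dQ_def[of n X] dQ_map_def
proof (rule frag_extend_generate_subset)
  show "subgroup (dD n Y) (free_Abelian_group {T. 0 \<le> n \<and> T \<in> digital_cubes (nat n) Y})"
    using subgroup_dD[of n Y] by (simp add: dQ_def)
qed (use compose_in_digital_cubes[OF _ f] compose_in_degenerate_cubes[OF _ f] degenerate_in_dD
      degenerate_cubes_subset in auto)

lemma dC_map_hom: "dC_map n Y f \<in> hom (dC n X) (dC n Y)"
  unfolding dC_map_eq dC_def
  by (rule group_hom.quotient_map_hom[OF group_hom_dQ_map normal_dD normal_dD dQ_map_dD])

lemma dC_map_coset: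
  "z \<in> carrier (dQ n X) \<Longrightarrow> dC_map n Y f (dD n X #>\<^bsub>dQ n X\<^esub> z)
    = dD n Y #>\<^bsub>dQ n Y\<^esub> dQ_map (nat n) f z"
  unfolding dC_map_eq
  by (rule group_hom.quotient_map_coset[OF group_hom_dQ_map subgroup_dD subgroup_dD dQ_map_dD])

text \<open>By \<open>boundary_dQ_map\<close>, both sides send the coset of \<open>z\<close> to the
  coset of the same chain.\<close>

lemma dC_map_boundary:
  assumes "c \<in> carrier (dC n X)"
  shows "dC_boundary n Y (dC_map n Y f c) = dC_map (n - 1) Y f (dC_boundary n X c)"
proof -
  obtain z where z: "z \<in> carrier (dQ n X)" and c: "c = dD n X #>\<^bsub>dQ n X\<^esub> z"
    using assms by (auto simp: carrier_dC)
  have "nat (n - 1) = nat n - 1"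
    by simp
  then show ?thesis
    using group_hom.hom_closed[OF group_hom_dQ_map z] group_hom.hom_closed[OF group_hom_boundary z]
    by (simp only: c dC_map_coset dC_boundary_coset z boundary_dQ_map)
qed

end

lemma dC_map_id:
  assumes "c \<in> carrier (dC n X)"
  shows "dC_map n X (\<lambda>x\<in>points X. x) c = c"
proof -
  have "digital_continuous X X (\<lambda>x\<in>points X. x)"
    by (auto simp: digital_continuous_def)
  then show ?thesis
    using assms by (auto simp: carrier_dC dC_map_coset dQ_map_id)
qed

lemma digital_continuous_compose:
  assumes "digital_continuous X Y f" "digital_continuous Y Z g"
  shows "digital_continuous X Z (compose (points X) g f)"
  using assms by (auto simp: digital_continuous_def compose_eq Pi_iff) metis

lemma dC_map_compose:
  assumes f: "digital_continuous X Y f" and g: "digital_continuous Y Z g"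
    and c: "c \<in> carrier (dC n X)"
  shows "dC_map n Z (compose (points X) g f) c = dC_map n Z g (dC_map n Y f c)"
  using c group_hom.hom_closed[OF group_hom_dQ_map[OF f]]
  by (auto simp: carrier_dC dC_map_coset[OF f] dC_map_coset[OF g]
      dC_map_coset[OF digital_continuous_compose[OF f g]] dQ_map_compose)


section \<open>Homology\<close>

lemma group_hom_dC_boundary: "group_hom (dC n X) (dC (n - 1) X) (dC_boundary n X)"
  by (simp add: group_hom_def group_hom_axioms_def group_dC dC_boundary_hom)

lemma carrier_dZ: "c \<in> carrier (dZ n X) \<longleftrightarrow>
    c \<in> carrier (dC n X) \<and> dC_boundary n X c = \<one>\<^bsub>dC (n - 1) X\<^esub>"
  by (simp add: dZ_def kernel_def)

lemma mult_dZ: "(\<otimes>\<^bsub>dZ n X\<^esub>) = (\<otimes>\<^bsub>dC n X\<^esub>)"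
  by (simp add: dZ_def)

lemma group_dZ: "group (dZ n X)"
  unfolding dZ_def
  by (intro group.subgroup_imp_group[OF group_dC] group_hom.subgroup_kernel[OF group_hom_dC_boundary])

lemma comm_group_dZ: "comm_group (dZ n X)"
  using comm_monoid.m_comm[OF comm_group.axioms(1)[OF comm_group_dC]]
  by (intro group.group_comm_groupI[OF group_dZ]) (simp add: carrier_dZ mult_dZ)

text \<open>As the image of a homomorphism, \<open>dB n X\<close> is a subgroup of
  \<open>dC n X\<close>; the vanishing double boundary, taken in degree n + 1, places it inside the
  cycles.\<close>

lemma subgroup_dB: "subgroup (dB n X) (dZ n X)"
proof -
  have hom: "group_hom (dC (n + 1) X) (dC n X) (dC_boundary (n + 1) X)"
    using group_hom_dC_boundary[of "n + 1" X] by simp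
  have "dB n X \<subseteq> kernel (dC n X) (dC (n - 1) X) (dC_boundary n X)"
    using group_hom.hom_closed[OF hom] dC_boundary_boundary[of _ "n + 1" X]
    by (auto simp: dB_def kernel_def)
  moreover have "subgroup (dB n X) (dC n X)"
    unfolding dB_def by (rule group_hom.img_is_subgroup[OF hom])
  ultimately show ?thesis
    unfolding dZ_def
    by (intro group.subgroup_incl[OF group_dC] group_hom.subgroup_kernel[OF group_hom_dC_boundary])
qed

lemma normal_dB: "dB n X \<lhd> dZ n X"
  using comm_group.subgroup_imp_normal[OF comm_group_dZ subgroup_dB] .

lemma comm_group_dH: "comm_group (dH n X)"
  unfolding dH_def by (rule comm_group.abelian_FactGroup[OF comm_group_dZ subgroup_dB])

lemma carrier_dH: "carrier (dH n X) = (\<lambda>c. dB n X #>\<^bsub>dZ n X\<^esub> c) ` carrier (dZ n X)"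
  by (simp add: dH_def carrier_FactGroup)

lemma dH_map_extensional: "dH_map n X Y f \<in> extensional (carrier (dH n X))"
  by (simp add: dH_map_def)

section \<open>Induced maps on homology\<close>

context
  fixes X Y :: digital_image and f :: "point \<Rightarrow> point"
  assumes f: "digital_continuous X Y f"
begin

lemma group_hom_dC_map: "group_hom (dC n X) (dC n Y) (dC_map n Y f)"
  by (simp add: group_hom_def group_hom_axioms_def group_dC dC_map_hom[OF f])

text \<open>Commuting with the boundary and preserving the unit, the chain map sends cycles to
  cycles.\<close>

lemma group_hom_dZ_map: "group_hom (dZ n X) (dZ n Y) (dC_map n Y f)"
proof -
  have "dC_map n Y f \<in> hom (dZ n X) (dZ n Y)"
    using group_hom.hom_closed[OF group_hom_dC_map] group_hom.hom_mult[OF group_hom_dC_map]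
      group_hom.hom_one[OF group_hom_dC_map]
    by (intro homI) (auto simp: carrier_dZ mult_dZ dC_map_boundary[OF f])
  then show ?thesis
    by (simp add: group_hom_def group_hom_axioms_def group_dZ)
qed

lemma dC_map_dB: "dC_map n Y f ` dB n X \<subseteq> dB n Y"
proof -
  have "dC_map n Y f (dC_boundary (n + 1) X c) = dC_boundary (n + 1) Y (dC_map (n + 1) Y f c)"
    if "c \<in> carrier (dC (n + 1) X)" for c
    using dC_map_boundary[OF f that] by simp
  then show ?thesis
    using group_hom.hom_closed[OF group_hom_dC_map] by (auto simp: dB_def)
qed

lemma dH_map_hom: "dH_map n X Y f \<in> hom (dH n X) (dH n Y)"
proof -
  have "quotient_map (dZ n Y) (dB n Y) (dC_map n Y f) \<in> hom (dH n X) (dH n Y)"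
    unfolding dH_def
    by (rule group_hom.quotient_map_hom[OF group_hom_dZ_map normal_dB normal_dB dC_map_dB])
  \<comment> \<open>Restricting to the carrier keeps the homomorphism law because products stay in
    the carrier.\<close>
  then show ?thesis
    using comm_group_dH[of n X]
    by (auto simp: dH_map_def hom_def Pi_iff comm_group_def group_def monoid.m_closed)
qed

lemma dH_map_coset:
  assumes "c \<in> carrier (dZ n X)"
  shows "dH_map n X Y f (dB n X #>\<^bsub>dZ n X\<^esub> c) = dB n Y #>\<^bsub>dZ n Y\<^esub> dC_map n Y f c"
  using assms group_hom.quotient_map_coset[OF group_hom_dZ_map subgroup_dB subgroup_dB dC_map_dB assms]
  by (simp add: dH_map_def carrier_dH)

end

text \<open>Both functions are extensional, so it suffices to compare them on classes, and
  \<open>dC_map\<close> fixes the representing cycle.\<close>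

lemma dH_map_id: "dH_map n X X (\<lambda>x\<in>points X. x) = (\<lambda>x\<in>carrier (dH n X). x)"
proof (rule extensionalityI[OF dH_map_extensional])
  fix a assume "a \<in> carrier (dH n X)"
  moreover have "digital_continuous X X (\<lambda>x\<in>points X. x)"
    by (auto simp: digital_continuous_def)
  ultimately show "dH_map n X X (\<lambda>x\<in>points X. x) a = (\<lambda>x\<in>carrier (dH n X). x) a"
    by (auto simp: carrier_dH dH_map_coset dC_map_id carrier_dZ)
qed simp

lemma dH_map_compose:
  assumes f: "digital_continuous X Y f" and g: "digital_continuous Y Z g"
  shows "dH_map n X Z (compose (points X) g f)
    = compose (carrier (dH n X)) (dH_map n Y Z g) (dH_map n X Y f)"
proof (rule extensionalityI[OF dH_map_extensional])
  fix a assume a: "a \<in> carrier (dH n X)"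
  then obtain c where c: "c \<in> carrier (dZ n X)" and a_eq: "a = dB n X #>\<^bsub>dZ n X\<^esub> c"
    by (auto simp: carrier_dH)
  \<comment> \<open>The image must be a cycle before \<open>dH_map_coset\<close> for
    \<open>g\<close> can be applied to its class.\<close>
  have "dC_map n Y f c \<in> carrier (dZ n Y)"
    using group_hom.hom_closed[OF group_hom_dZ_map[OF f] c] .
  then show "dH_map n X Z (compose (points X) g f) a
      = compose (carrier (dH n X)) (dH_map n Y Z g) (dH_map n X Y f) a"
    using a c
    by (simp add: a_eq compose_eq dH_map_coset[OF f] dH_map_coset[OF g]
        dH_map_coset[OF digital_continuous_compose[OF f g]] dC_map_compose[OF f g] carrier_dZ)
qed (rule compose_extensional)

section \<open>The two categories and the functor\<close>

lemma is_category_Dig: "is_category Dig"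
proof
  fix X Y Z f g
  assume "f \<in> Hom Dig X Y" "g \<in> Hom Dig Y Z"
  then show "Comp Dig X Y Z g f \<in> Hom Dig X Z"
    by (auto simp: Dig_def intro: digital_continuous_compose)
\<comment> \<open>The unit laws hold as equations of functions because morphisms are
  extensional.\<close>
qed (auto simp: Dig_def digital_continuous_def Id_compose compose_Id intro: compose_assoc)

lemma is_category_Ab: "is_category Ab"
proof
  fix X Y Z :: "'a monoid" and f g
  assume "X \<in> Obj Ab" "f \<in> Hom Ab X Y" "g \<in> Hom Ab Y Z"
  then show "Comp Ab X Y Z g f \<in> Hom Ab X Z"
    by (auto simp: Ab_def comm_group_def intro: group.hom_compose)
qed (auto simp: Ab_def hom_def comm_group_def group_def monoid.m_closed Id_compose compose_Id
      intro: compose_assoc)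

theorem proposition3p4:
  fixes n :: int
  assumes "n \<ge> 0"
  shows "is_functor Dig Ab (dH n) (dH_map n)"
  \<comment> \<open>\<open>Ab\<close> is taken at the element type of \<open>dH n X\<close>, sets of
    cosets of chains.\<close>
  by (intro is_functor.intro is_functor_axioms.intro is_category_Dig is_category_Ab)
    (auto simp: Dig_def Ab_def comm_group_dH dH_map_hom dH_map_extensional dH_map_id dH_map_compose)

end
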